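(* Let $m \geq 3$ and $n = 2$. Let $A$ be the constraint matrix of the fixed-support Wasserstein barycenter linear program written as $A\,(\mathrm{vec}(X_1);\dots;\mathrm{vec}(X_m)) = ((-1)^1u_1;\,(-1)^2u_2;\dots;(-1)^m u_m;\,\mathbf{0}_n;\dots;\mathbf{0}_n)$, $X_k\ge 0$, as described in the context. Then $A$ is equivalent to a totally unimodular matrix: after removing a suitable set of redundant rows of $A$ (rows that are linear combinations of the remaining rows, so that the set of solutions of the linear system is unchanged), the resulting matrix is totally unimodular.
   Context: Fixed-support Wasserstein barycenter problem: given $m$ probability vectors $u_1,\dots,u_m \in \Delta^n=\{v\in\mathbb{R}^n_+:\mathbf{1}_n^\top v=1\}$ and nonnegative cost matrices $C_1,\dots,C_m\in\mathbb{R}_+^{n\times n}$, minimize $\sum_{k=1}^m \langle C_k, X_k\rangle$ over $X_1,\dots,X_m\in\mathbb{R}_+^{n\times n}$ subject to $X_k\mathbf{1}_n=u_k$ for all $k\in[m]$ and $X_{k+1}^\top\mathbf{1}_n=X_k^\top\mathbf{1}_n$ for all $k\in[m-1]$. Write $\mathrm{vec}(X)\in\mathbb{R}^{n^2}$ for the row-major vectorization $(X_{11},\dots,X_{1n},X_{21},\dots,X_{nn})$, and let $E=I_n\otimes\mathbf{1}_n^\top\in\mathbb{R}^{n\times n^2}$ and $G=\mathbf{1}_n^\top\otimes I_n\in\mathbb{R}^{n\times n^2}$ (so $E\,\mathrm{vec}(X)=X\mathbf{1}_n$ and $G\,\mathrm{vec}(X)=X^\top\mathbf{1}_n$). The constraint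 matrix $A\in\mathbb{R}^{(2m-1)n\times mn^2}$ consists of $2m-1$ block rows and $m$ block columns (each block column of width $n^2$): for $k=1,\dots,m$, block row $k$ has $(-1)^kE$ in block column $k$ and zeros elsewhere; for $k=1,\dots,m-1$, block row $m+k$ has $(-1)^{k+1}G$ in block column $k$, $(-1)^{k}G$ in block column $k+1$, and zeros elsewhere. A matrix is totally unimodular if every square submatrix has determinant in $\{-1,0,1\}$. *)

theory Defs
  imports "Jordan_Normal_Form.VS_Connect" "Jordan_Normal_Form.DL_Submatrix"
begin

definition kronecker :: "real mat \<Rightarrow> real mat \<Rightarrow> real mat" where
  "kronecker A B = mat (dim_row A * dim_row B) (dim_col A * dim_col B)
     (\<lambda>(i, j). A $$ (i div dim_row B, j div dim_col B) * B $$ (i mod dim_row B, j mod dim_col B))"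

definition ones_row :: "nat \<Rightarrow> real mat" where
  "ones_row n = mat 1 n (\<lambda>_. 1)"

definition E_mat :: "nat \<Rightarrow> real mat" where
  "E_mat n = kronecker (1\<^sub>m n) (ones_row n)"

definition G_mat :: "nat \<Rightarrow> real mat" where
  "G_mat n = kronecker (ones_row n) (1\<^sub>m n)"

text \<open>Block rows \<open>r \<in> {1..2*m-1}\<close> and block columns \<open>c \<in> {1..m}\<close> are numbered from 1, so that the
  signs read as in the usual presentation; entries inside matrices are indexed from 0.\<close>

definition barycenter_block :: "nat \<Rightarrow> nat \<Rightarrow> nat \<Rightarrow> nat \<Rightarrow> real mat" where
  "barycenter_block m n r c =
     (if r \<le> m then
        (if c = r then (-1) ^ r \<cdot>\<^sub>m E_mat n else 0\<^sub>m n (n\<^sup>2))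
      else
        (let k = r - m in
         if c = k then (-1) ^ (k + 1) \<cdot>\<^sub>m G_mat n
         else if c = k + 1 then (-1) ^ k \<cdot>\<^sub>m G_mat n
         else 0\<^sub>m n (n\<^sup>2)))"

definition barycenter_mat :: "nat \<Rightarrow> nat \<Rightarrow> real mat" where
  "barycenter_mat m n = mat ((2 * m - 1) * n) (m * n\<^sup>2)
     (\<lambda>(i, j). barycenter_block m n (i div n + 1) (j div n\<^sup>2 + 1) $$ (i mod n, j mod n\<^sup>2))"

definition prob_simplex :: "nat \<Rightarrow> real vec set" where
  "prob_simplex n = {v \<in> carrier_vec n. (\<forall>i<n. 0 \<le> v $ i) \<and> (\<Sum>i<n. v $ i) = 1}"

text \<open>The right-hand side; the marginals are \<open>u 1, \<dots>, u m\<close>.\<close>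

definition barycenter_rhs :: "nat \<Rightarrow> nat \<Rightarrow> (nat \<Rightarrow> real vec) \<Rightarrow> real vec" where
  "barycenter_rhs m n u = vec ((2 * m - 1) * n)
     (\<lambda>i. let k = i div n + 1 in if k \<le> m then (-1) ^ k * u k $ (i mod n) else 0)"

definition solutions :: "real mat \<Rightarrow> real vec \<Rightarrow> real vec set" where
  "solutions A b = {x \<in> carrier_vec (dim_col A). A *\<^sub>v x = b}"

definition remove_rows :: "real mat \<Rightarrow> nat set \<Rightarrow> real mat" where
  "remove_rows A R = submatrix A (- R) UNIV"

definition remove_entries :: "real vec \<Rightarrow> nat set \<Rightarrow> real vec" where
  "remove_entries b R = vec (card {i. i < dim_vec b \<and> i \<in> - R}) (\<lambda>i. b $ pick (- R) i)"

definition redundant_rows :: "real mat \<Rightarrow> nat set \<Rightarrow> bool" where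
  "redundant_rows A R \<longleftrightarrow> R \<subseteq> {..<dim_row A} \<and>
     (\<forall>i\<in>R. row A i \<in> vec_space.row_space (dim_col A) (remove_rows A R))"

definition totally_unimodular :: "real mat \<Rightarrow> bool" where
  "totally_unimodular A \<longleftrightarrow>
     (\<forall>I J. I \<subseteq> {..<dim_row A} \<longrightarrow> J \<subseteq> {..<dim_col A} \<longrightarrow> card I = card J \<longrightarrow>
        det (submatrix A I J) \<in> {-1, 0, 1})"

end

theory Submission
  imports Defs
begin

text \<open>Writing \<open>e\<^sub>k\<close> for the sum of the two rows of block row \<open>k\<close> and \<open>g\<^sub>k\<close>, \<open>h\<^sub>k\<close> for the two rows of
  block row \<open>m + k\<close>, the signs are such that \<open>e\<^sub>k + e\<^sub>k\<^sub>+\<^sub>1 + g\<^sub>k + h\<^sub>k = 0\<close>; hence all \<open>h\<^sub>k\<close> are redundant.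
  In any square submatrix of what remains, a row or column with at most one nonzero entry is peeled
  off by Laplace expansion. If there is none, then only rows \<open>g\<^sub>k\<close> occur, each column has exactly
  two nonzero entries, in rows \<open>g\<^sub>k\<close> and \<open>g\<^sub>k\<^sub>+\<^sub>1\<close>, and these cancel when \<open>g\<^sub>k\<close> is weighted by \<open>(-1)\<^sup>k\<close>,
  so the determinant vanishes.\<close>

section \<open>Determinants of peelable matrices\<close>

lemma sum_single_support_unimodular:
  fixes F :: "nat \<Rightarrow> 'a :: comm_ring_1" and h :: "nat \<Rightarrow> 'b"
  assumes F: "\<And>k. k < n \<Longrightarrow> F k \<in> {-1, 0, 1}"
    and support: "\<And>k. k < n \<Longrightarrow> h k \<noteq> x \<Longrightarrow> F k = 0"
    and inj: "inj_on h {..<n}"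
  shows "(\<Sum>k<n. F k) \<in> {-1, 0, 1}"
proof (cases "x \<in> h ` {..<n}")
  case True
  then obtain k where k: "k < n" "h k = x" by auto
  have "(\<Sum>k<n. F k) = F k"
    using k support inj by (subst sum.remove[of _ k]) (auto intro!: sum.neutral simp: inj_on_def)
  then show ?thesis using F[OF k(1)] by simp
next
  case False
  then have "(\<Sum>k<n. F k) = 0"
    using support by (auto intro!: sum.neutral)
  then show ?thesis by simp
qed

text \<open>Induction on the size. A row or column with at most one nonzero entry leaves at most one
  term in its Laplace expansion, and that term is a sign times an entry times a smaller determinant
  of the same kind; weights that annihilate the columns make the determinant zero. Rows and columns
  carry labels through injective \<open>f\<close> and \<open>g\<close>, and \<open>peel\<close>
  speaks of all finite label sets, so the hypotheses pass to minors unchanged. The exceptional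
  \<open>c0\<close> and \<open>r0\<close> need not lie in \<open>J\<close> and \<open>I\<close>, so
  zero rows and columns are covered too.\<close>

lemma det_mat_peeling:
  fixes a :: "'r \<Rightarrow> 'c \<Rightarrow> 'a :: idom"
  assumes entries: "\<And>r c. r \<in> S \<Longrightarrow> c \<in> T \<Longrightarrow> a r c \<in> {-1, 0, 1}"
    and peel: "\<And>I J. finite I \<Longrightarrow> finite J \<Longrightarrow> I \<noteq> {} \<Longrightarrow> J \<noteq> {} \<Longrightarrow> I \<subseteq> S \<Longrightarrow> J \<subseteq> T \<Longrightarrow>
      (\<exists>r\<in>I. \<exists>c0. \<forall>c\<in>J. c \<noteq> c0 \<longrightarrow> a r c = 0) \<or>
      (\<exists>c\<in>J. \<exists>r0. \<forall>r\<in>I. r \<noteq> r0 \<longrightarrow> a r c = 0) \<or>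
      (\<exists>w. (\<exists>r\<in>I. w r \<noteq> 0) \<and> (\<forall>c\<in>J. (\<Sum>r\<in>I. w r * a r c) = 0))"
    and "inj_on f {..<n}" "f ` {..<n} \<subseteq> S" "inj_on g {..<n}" "g ` {..<n} \<subseteq> T"
  shows "det (mat n n (\<lambda>(i, j). a (f i) (g j))) \<in> {-1, 0, 1}"
  using assms(3-6)
proof (induction n arbitrary: f g)
  case 0
  then show ?case by (simp add: det_dim_zero)
next
  case (Suc n)
  define M where "M = mat (Suc n) (Suc n) (\<lambda>(i, j). a (f i) (g j))"
  have M: "M \<in> carrier_mat (Suc n) (Suc n)" by (simp add: M_def)
  \<comment> \<open>Deleting row \<open>i\<close> and column \<open>j\<close> only precomposes the
    labellings with \<open>insert_index\<close>, which keeps them injective, so the induction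
    hypothesis bounds the minor.\<close>
  have cof: "M $$ (i, j) * cofactor M i j \<in> {-1, 0, 1}" if i: "i < Suc n" and j: "j < Suc n" for i j
  proof -
    have ins: "inj_on (insert_index k) {..<n}" "insert_index k ` {..<n} \<subseteq> {..<Suc n}" for k
      by (auto simp: inj_on_def insert_index_def)
    have "mat_delete M i j = mat n n (\<lambda>(i', j'). a ((f \<circ> insert_index i) i') ((g \<circ> insert_index j) j'))"
      by (rule eq_matI) (auto simp: mat_delete_def M_def insert_index_def)
    moreover have "det (mat n n (\<lambda>(i', j'). a ((f \<circ> insert_index i) i') ((g \<circ> insert_index j) j'))) \<in> {-1, 0, 1}"
    proof (rule Suc.IH)
      show "inj_on (f \<circ> insert_index i) {..<n}" "inj_on (g \<circ> insert_index j) {..<n}"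
        using ins(1) inj_on_subset[OF Suc.prems(1) ins(2)] inj_on_subset[OF Suc.prems(3) ins(2)]
        by (auto intro!: comp_inj_on)
      show "(f \<circ> insert_index i) ` {..<n} \<subseteq> S" "(g \<circ> insert_index j) ` {..<n} \<subseteq> T"
        using ins Suc.prems(2,4) by (fastforce simp: image_subset_iff)+
    qed
    ultimately have "det (mat_delete M i j) \<in> {-1, 0, 1}" by simp
    moreover have "M $$ (i, j) \<in> {-1, 0, 1}"
      using entries[of "f i" "g j"] i j Suc.prems(2,4) by (auto simp: M_def image_subset_iff)
    moreover have "(-1) ^ (i + j) = (1::'a) \<or> (-1) ^ (i + j) = (-1::'a)"
      by (cases "even (i + j)") auto
    ultimately show ?thesis by (auto simp: cofactor_def)
  qed
  consider
      (row) i c0 where "i < Suc n" "\<And>j. j < Suc n \<Longrightarrow> g j \<noteq> c0 \<Longrightarrow> a (f i) (g j) = 0"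
    | (col) j r0 where "j < Suc n" "\<And>i. i < Suc n \<Longrightarrow> f i \<noteq> r0 \<Longrightarrow> a (f i) (g j) = 0"
    | (weights) w i where "i < Suc n" "w (f i) \<noteq> 0"
        "\<And>j. j < Suc n \<Longrightarrow> (\<Sum>r\<in>f ` {..<Suc n}. w r * a r (g j)) = 0"
    using peel[of "f ` {..<Suc n}" "g ` {..<Suc n}"] Suc.prems(2,4) by fastforce
  then have "det M \<in> {-1, 0, 1}"
  proof cases
    case row
    show ?thesis
      unfolding laplace_expansion_row[OF M row(1)]
      by (rule sum_single_support_unimodular[where h = g and x = c0]) (use cof row Suc.prems(3) in \<open>auto simp: M_def\<close>)
  next
    case col
    show ?thesis
      unfolding laplace_expansion_column[OF M col(1)]
      by (rule sum_single_support_unimodular[where h = f and x = r0]) (use cof col Suc.prems(1) in \<open>auto simp: M_def\<close>)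
  next
    case weights
    define v where "v = vec (Suc n) (\<lambda>i. w (f i))"
    \<comment> \<open>The weights, read along the row labelling, form a nonzero left null vector of
      \<open>M\<close>.\<close>
    have "transpose_mat M *\<^sub>v v = 0\<^sub>v (Suc n)"
    proof (rule eq_vecI)
      fix j assume "j < dim_vec (0\<^sub>v (Suc n) :: 'a vec)"
      then have j: "j < Suc n" by simp
      have "(transpose_mat M *\<^sub>v v) $ j = (\<Sum>i<Suc n. w (f i) * a (f i) (g j))"
        using j by (simp add: M_def v_def scalar_prod_def mult.commute atLeast0LessThan del: sum.lessThan_Suc sum.op_ivl_Suc)
      also have "\<dots> = (\<Sum>r\<in>f ` {..<Suc n}. w r * a r (g j))"
        using Suc.prems(1) by (simp add: sum.reindex del: sum.lessThan_Suc)
      finally show "(transpose_mat M *\<^sub>v v) $ j = 0\<^sub>v (Suc n) $ j" using weights(3) j by simp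
    qed (simp add: M_def)
    moreover have "v \<noteq> 0\<^sub>v (Suc n)"
      using weights(1,2) by (metis v_def index_vec index_zero_vec(1))
    ultimately have "det (transpose_mat M) = 0"
      using M by (subst det_0_iff_vec_prod_zero[of _ "Suc n"]) (auto simp: v_def intro!: exI[of _ v])
    then show ?thesis using det_transpose[OF M] by simp
  qed
  then show ?case by (simp add: M_def)
qed

section \<open>Row removal: surviving rows, solution sets and submatrices\<close>

lemma row_in_rows_remove_rows:
  assumes "i < dim_row A" "i \<notin> R"
  shows "row A i \<in> set (rows (remove_rows A R))"
proof -
  \<comment> \<open>The new position of row \<open>i\<close> is the number of kept indices below it;
    \<open>pick\<close> inverts this count.\<close>
  define k where "k = card {a \<in> - R. a < i}"
  have k: "k < card {a. a < dim_row A \<and> a \<in> - R}"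
    unfolding k_def using assms by (intro psubset_card_mono) auto
  have "pick (- R) k = i"
    unfolding k_def using assms by (intro pick_card_in_set) auto
  then have "row (remove_rows A R) k = row A i"
    using k assms by (intro eq_vecI) (auto simp: remove_rows_def submatrix_def pick_UNIV)
  then show ?thesis
    using k by (metis remove_rows_def dim_submatrix(1) length_rows nth_mem nth_rows)
qed

lemma rows_remove_rows_carrier: "set (rows (remove_rows A R)) \<subseteq> carrier_vec (dim_col A)"
  by (auto simp: rows_def remove_rows_def submatrix_def)

lemma solutions_remove_rows:
  assumes "dim_vec b = dim_row A"
  shows "solutions (remove_rows A R) (remove_entries b R) =
    {x \<in> carrier_vec (dim_col A). \<forall>i<dim_row A. i \<notin> R \<longrightarrow> row A i \<bullet> x = b $ i}"
proof -
  let ?d = "card {i. i < dim_row A \<and> i \<in> - R}"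
  have row: "row (remove_rows A R) k = row A (pick (- R) k)" if "k < ?d" for k
    using that pick_le[OF that] by (intro eq_vecI) (auto simp: remove_rows_def submatrix_def pick_UNIV)
  have picked: "remove_rows A R *\<^sub>v x = remove_entries b R \<longleftrightarrow>
      (\<forall>k<?d. row A (pick (- R) k) \<bullet> x = b $ pick (- R) k)" for x
  proof -
    have lhs: "remove_rows A R *\<^sub>v x = vec ?d (\<lambda>k. row A (pick (- R) k) \<bullet> x)"
      using row by (intro eq_vecI) (auto simp: remove_rows_def dim_submatrix)
    have rhs: "remove_entries b R = vec ?d (\<lambda>k. b $ pick (- R) k)"
      using assms by (simp add: remove_entries_def)
    show ?thesis unfolding lhs rhs by (auto simp: vec_eq_iff)
  qed
  have reindex: "(\<forall>k<?d. P (pick (- R) k)) \<longleftrightarrow> (\<forall>i<dim_row A. i \<notin> R \<longrightarrow> P i)" for P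
  proof (intro iffI allI impI)
    fix i assume P: "\<forall>k<?d. P (pick (- R) k)" and i: "i < dim_row A" "i \<notin> R"
    have "card {a \<in> - R. a < i} < ?d"
      using i by (intro psubset_card_mono) auto
    with P have "P (pick (- R) (card {a \<in> - R. a < i}))" by blast
    then show "P i" using i pick_card_in_set[of i "- R"] by simp
  next
    fix k assume P: "\<forall>i<dim_row A. i \<notin> R \<longrightarrow> P i" and k: "k < ?d"
    \<comment> \<open>The set \<open>- R\<close> may be infinite; cutting it off at
      \<open>dim_row A\<close> makes it finite without changing its first \<open>?d\<close>
      elements, and membership then includes the bound.\<close>
    have "pick (- R) k \<in> {a. a < dim_row A \<and> a \<in> - R}"
      unfolding pick_reduce_set[OF k] using k by (intro pick_in_set_le)
    then show "P (pick (- R) k)" using P by blast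
  qed
  have "dim_col (remove_rows A R) = dim_col A" by (simp add: remove_rows_def dim_submatrix)
  then show ?thesis
    unfolding solutions_def picked reindex[where P = "\<lambda>i. row A i \<bullet> _ = b $ i"] by simp
qed

text \<open>A square submatrix of the reduced matrix is \<open>A\<close> itself read through
  increasing row and column labellings. Peeling can therefore be checked on the original row
  numbers, with no renumbering after the removal.\<close>

lemma totally_unimodular_remove_rows_peeling:
  assumes entries: "\<And>r c. r \<in> {..<dim_row A} - R \<Longrightarrow> c < dim_col A \<Longrightarrow> A $$ (r, c) \<in> {-1, 0, 1}"
    and peel: "\<And>I J. finite I \<Longrightarrow> finite J \<Longrightarrow> I \<noteq> {} \<Longrightarrow> J \<noteq> {} \<Longrightarrow>
      I \<subseteq> {..<dim_row A} - R \<Longrightarrow> J \<subseteq> {..<dim_col A} \<Longrightarrow>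
      (\<exists>r\<in>I. \<exists>c0. \<forall>c\<in>J. c \<noteq> c0 \<longrightarrow> A $$ (r, c) = 0) \<or>
      (\<exists>c\<in>J. \<exists>r0. \<forall>r\<in>I. r \<noteq> r0 \<longrightarrow> A $$ (r, c) = 0) \<or>
      (\<exists>w. (\<exists>r\<in>I. w r \<noteq> 0) \<and> (\<forall>c\<in>J. (\<Sum>r\<in>I. w r * A $$ (r, c)) = 0))"
  shows "totally_unimodular (remove_rows A R)"
  unfolding totally_unimodular_def
proof (intro allI impI)
  fix I J
  let ?B = "remove_rows A R"
  assume I: "I \<subseteq> {..<dim_row ?B}" and J: "J \<subseteq> {..<dim_col ?B}" and card: "card I = card J"
  let ?n = "card I"
  let ?S = "{a. a < dim_row A \<and> a \<in> - R}"
  have dim: "dim_row ?B = card ?S" "dim_col ?B = dim_col A"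
    by (auto simp: remove_rows_def dim_submatrix)
  have I': "{i. i < dim_row ?B \<and> i \<in> I} = I" and J': "{j. j < dim_col ?B \<and> j \<in> J} = J"
    using I J by auto
  have pI: "pick I i \<in> I" "pick I i < card ?S" if "i < ?n" for i
    using pick_in_set_le[OF that] I dim by auto
  have pJ: "pick J j \<in> J" "pick J j < dim_col A" if "j < ?n" for j
    using pick_in_set_le[of j J] that card J dim by auto
  have pS: "pick (- R) k \<in> ?S" if k: "k < card ?S" for k
    unfolding pick_reduce_set[OF k] using k by (intro pick_in_set_le)
  \<comment> \<open>Two selections are composed: \<open>pick I\<close> chooses a row of the reduced
    matrix, and \<open>pick (- R)\<close> gives its number in \<open>A\<close>.\<close>
  define f where "f i = pick (- R) (pick I i)" for i
  have inj_pick: "inj_on (pick X) {..<card X}" for X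
    by (rule linorder_inj_onI) (use pick_mono_le in fastforce)+
  have "inj_on (pick (- R)) {..<card ?S}"
    using inj_pick[of ?S] pick_reduce_set[of _ "dim_row A" "- R"] by (simp add: inj_on_def)
  then have inj_f: "inj_on f {..<?n}"
    using inj_pick[of I] pI unfolding f_def inj_on_def by blast
  have "submatrix ?B I J = mat ?n ?n (\<lambda>(i, j). A $$ (f i, pick J j))"
    using pI pJ card
    by (intro eq_matI)
      (auto simp: submatrix_def[of ?B] I' J' f_def, auto simp: remove_rows_def submatrix_index pick_UNIV)
  moreover have "det (mat ?n ?n (\<lambda>(i, j). A $$ (f i, pick J j))) \<in> {-1, 0, 1}"
  proof (rule det_mat_peeling[where S = "{..<dim_row A} - R" and T = "{..<dim_col A}"
        and a = "\<lambda>r c. A $$ (r, c)" and f = f and g = "pick J"])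
    show "f ` {..<?n} \<subseteq> {..<dim_row A} - R" using pS pI by (fastforce simp: f_def)
    show "pick J ` {..<?n} \<subseteq> {..<dim_col A}" using pJ by auto
    show "inj_on (pick J) {..<?n}" using inj_pick[of J] card by simp
  qed (use entries peel inj_f in auto)
  ultimately show "det (submatrix ?B I J) \<in> {-1, 0, 1}" by simp
qed

section \<open>Entries of the constraint matrix for n = 2\<close>

lemma dim_barycenter_mat_2 [simp]:
  "dim_row (barycenter_mat m 2) = 2 * (2 * m - 1)" "dim_col (barycenter_mat m 2) = 4 * m"
  by (auto simp: barycenter_mat_def)

lemma E_mat_2: "i < 2 \<Longrightarrow> j < 4 \<Longrightarrow> E_mat 2 $$ (i, j) = (if j div 2 = i then 1 else 0)"
  by (auto simp: E_mat_def kronecker_def ones_row_def less_mult_imp_div_less)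

lemma G_mat_2: "i < 2 \<Longrightarrow> j < 4 \<Longrightarrow> G_mat 2 $$ (i, j) = (if j mod 2 = i then 1 else 0)"
  by (auto simp: G_mat_def kronecker_def ones_row_def less_mult_imp_div_less)

lemma dim_E_G_mat [simp]:
  "dim_row (E_mat n) = n" "dim_col (E_mat n) = n * n" "dim_row (G_mat n) = n" "dim_col (G_mat n) = n * n"
  by (auto simp: E_mat_def G_mat_def kronecker_def ones_row_def)

text \<open>Counting from 0, column \<open>j\<close> stands for the entry in row
  \<open>j mod 4 div 2\<close> and column \<open>j mod 2\<close> of matrix number
  \<open>j div 4\<close>. Matrix number and row together are coded by \<open>j div 2\<close>, which
  is exactly how the upper rows are numbered. The exponent is the block number counted from
  1.\<close>

lemma barycenter_mat_2_upper:
  assumes "i < 2 * m" "j < 4 * m"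
  shows "barycenter_mat m 2 $$ (i, j) = (if j div 2 = i then (-1) ^ (i div 2 + 1) else 0)"
proof -
  have "i div 2 + 1 \<le> m" using assms by auto
  moreover have "i < (2 * m - 1) * 2" using assms by presburger
  moreover have "j div 2 = i \<longleftrightarrow> j div 4 = i div 2 \<and> j mod 4 div 2 = i mod 2"
  proof -
    have "j div 4 = j div 2 div 2" "j mod 4 div 2 = j div 2 mod 2" by presburger+
    then show ?thesis by (metis div_mult_mod_eq)
  qed
  moreover have "i mod 2 < 2" "j mod 4 < 4" by auto
  ultimately show ?thesis
    using assms by (auto simp: barycenter_mat_def barycenter_block_def E_mat_2)
qed

text \<open>Here \<open>k\<close> counts from 0, so the block row is m + (k + 1) in the numbering of
  \<open>barycenter_block\<close>; its signs with exponents k + 2 and k + 1 become the two displayed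
  here. The bit \<open>b\<close> selects the column whose sum is taken.\<close>

lemma barycenter_mat_2_lower:
  assumes "k < m - 1" "b < 2" "j < 4 * m"
  shows "barycenter_mat m 2 $$ (2 * m + 2 * k + b, j) =
    (if j mod 2 = b then if j div 4 = k then (-1) ^ k else if j div 4 = k + 1 then (-1) ^ (k + 1) else 0
     else 0)"
proof -
  have "2 * m + 2 * k + b < (2 * m - 1) * 2" using assms by auto
  moreover have "(2 * m + 2 * k + b) div 2 = m + k"
    by (rule div_nat_eqI) (use assms(2) in auto)
  moreover have "(2 * m + 2 * k + b) mod 2 = b"
  proof -
    have "2 * m + 2 * k + b = (m + k) * 2 + b" by simp
    then show ?thesis using assms(2) by (simp only: mod_mult_self3 mod_less)
  qed
  moreover have "j mod 4 mod 2 = j mod 2" by (rule mod_mod_cancel) simp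
  moreover have "j mod 4 < 4" by auto
  ultimately show ?thesis
    using assms by (auto simp: barycenter_mat_def barycenter_block_def Let_def G_mat_2)
qed

section \<open>Redundancy of the rows h_k, one from each lower block row\<close>

definition barycenter_redundant :: "nat \<Rightarrow> nat set" where
  "barycenter_redundant m = (\<lambda>k. 2 * m + 2 * k + 1) ` {..<m - 1}"

text \<open>Summing the rows of \<open>E_mat 2\<close> or of \<open>G_mat 2\<close> gives the
  all-ones row: both compute total mass. On each of the two matrices that lower block
  \<open>k\<close> couples, the signs of the upper and the lower block are opposite, so the sum of
  all six rows vanishes.\<close>

lemma row_barycenter_mat_2_redundant:
  assumes "k < m - 1"
  shows "row (barycenter_mat m 2) (2 * m + 2 * k + 1) = (-1) \<cdot>\<^sub>v
    (row (barycenter_mat m 2) (2 * m + 2 * k) +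
     (row (barycenter_mat m 2) (2 * k) + row (barycenter_mat m 2) (2 * k + 1)) +
     (row (barycenter_mat m 2) (2 * k + 2) + row (barycenter_mat m 2) (2 * k + 3)))"
proof (rule eq_vecI)
  let ?A = "barycenter_mat m 2"
  fix j assume "j < dim_vec ((-1) \<cdot>\<^sub>v (row ?A (2 * m + 2 * k) + (row ?A (2 * k) + row ?A (2 * k + 1)) +
     (row ?A (2 * k + 2) + row ?A (2 * k + 3))))"
  then have j: "j < 4 * m" by simp
  \<comment> \<open>The two rows of an upper block add up to a signed indicator of its four
    columns.\<close>
  have up: "?A $$ (2 * k, j) + ?A $$ (2 * k + 1, j) = (if j div 4 = k then (-1) ^ (k + 1) else 0)"
    if "k < m" for k
  proof -
    have "2 * k < 2 * m" "2 * k + 1 < 2 * m" using that by auto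
    moreover have "j div 4 = k \<longleftrightarrow> j div 2 = 2 * k \<or> j div 2 = 2 * k + 1"
    proof -
      have "j div 4 = j div 2 div 2" by presburger
      then show ?thesis by presburger
    qed
    ultimately show ?thesis
      using j by (auto simp: barycenter_mat_2_upper simp del: One_nat_def)
  qed
  have "?A $$ (2 * m + 2 * k + 1, j) = - (?A $$ (2 * m + 2 * k, j) +
     (?A $$ (2 * k, j) + ?A $$ (2 * k + 1, j)) + (?A $$ (2 * k + 2, j) + ?A $$ (2 * k + 3, j)))"
  proof -
    have "?A $$ (2 * m + 2 * k + 1, j) + ?A $$ (2 * m + 2 * k, j) =
        (if j div 4 = k then (-1) ^ k else if j div 4 = k + 1 then (-1) ^ (k + 1) else 0)"
      using barycenter_mat_2_lower[OF assms _ j, of 0] barycenter_mat_2_lower[OF assms _ j, of 1]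
      by (cases "j mod 2 = 0") simp_all
    moreover have "?A $$ (2 * k, j) + ?A $$ (2 * k + 1, j) = (if j div 4 = k then - ((-1) ^ k) else 0)"
      using up[of k] assms by simp
    moreover have "?A $$ (2 * k + 2, j) + ?A $$ (2 * k + 3, j) = (if j div 4 = k + 1 then (-1) ^ k else 0)"
      using up[of "k + 1"] assms by (simp add: numeral_3_eq_3)
    ultimately show ?thesis by (cases "j div 4 = k"; cases "j div 4 = k + 1") simp_all
  qed
  then show "row ?A (2 * m + 2 * k + 1) $ j = ((-1) \<cdot>\<^sub>v (row ?A (2 * m + 2 * k) +
     (row ?A (2 * k) + row ?A (2 * k + 1)) + (row ?A (2 * k + 2) + row ?A (2 * k + 3)))) $ j"
    using j assms by simp
qed simp

lemma redundant_rows_barycenter_mat_2: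
  "redundant_rows (barycenter_mat m 2) (barycenter_redundant m)"
  unfolding redundant_rows_def
proof (intro conjI ballI)
  let ?A = "barycenter_mat m 2" and ?R = "barycenter_redundant m"
  let ?W = "set (rows (remove_rows ?A ?R))"
  show "?R \<subseteq> {..<dim_row ?A}" by (auto simp: barycenter_redundant_def)
  interpret vec_space "TYPE(real)" "dim_col ?A" .
  have W: "?W \<subseteq> carrier_vec (dim_col ?A)" by (rule rows_remove_rows_carrier)
  have add: "v + w \<in> span ?W" if "v \<in> span ?W" "w \<in> span ?W" for v w
    using span_add1[of ?W v w] W that by simp
  fix i assume "i \<in> ?R"
  then obtain k where k: "k < m - 1" "i = 2 * m + 2 * k + 1" by (auto simp: barycenter_redundant_def)
  \<comment> \<open>This covers all five rows on the right of the dependency: four upper rows, and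
    the first row of the lower pair, which is kept because removed rows have odd numbers.\<close>
  have "row ?A r \<in> span ?W" if "r < 2 * m \<or> r = 2 * m + 2 * k" for r
  proof -
    have "r \<notin> ?R" using that unfolding barycenter_redundant_def by auto presburger
    moreover have "r < dim_row ?A" using that k by auto
    ultimately show ?thesis using row_in_rows_remove_rows W by (intro span_mem) auto
  qed
  moreover have "2 * k < 2 * m" "2 * k + 1 < 2 * m" "2 * k + 2 < 2 * m" "2 * k + 3 < 2 * m"
    using k(1) by linarith+
  ultimately show "row ?A i \<in> row_space (remove_rows ?A ?R)"
    unfolding row_space_def k(2) row_barycenter_mat_2_redundant[OF k(1)]
    by (intro smult_in_span[OF W] add) blast+
qed

text \<open>The right-hand side obeys the same dependency as the rows: two consecutive marginals
  have total mass 1 with opposite signs, and the lower entries are 0. Hence dropping the redundant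
  equations loses no constraint.\<close>

lemma barycenter_rhs_2_redundant:
  assumes "\<forall>k\<in>{1..m}. u k \<in> prob_simplex 2" "k < m - 1"
  shows "barycenter_rhs m 2 u $ (2 * m + 2 * k + 1) =
    - (barycenter_rhs m 2 u $ (2 * m + 2 * k) +
      (barycenter_rhs m 2 u $ (2 * k) + barycenter_rhs m 2 u $ (2 * k + 1)) +
      (barycenter_rhs m 2 u $ (2 * k + 2) + barycenter_rhs m 2 u $ (2 * k + 3)))"
proof -
  have "barycenter_rhs m 2 u $ (2 * k) + barycenter_rhs m 2 u $ (2 * k + 1) = (-1) ^ (k + 1)"
    if "k < m" for k
  proof -
    have "2 * k < (2 * m - 1) * 2" "2 * k + 1 < (2 * m - 1) * 2" using that by linarith+
    moreover have "u (k + 1) $ 0 + u (k + 1) $ 1 = 1"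
      using assms(1) that by (auto simp: prob_simplex_def numeral_2_eq_2)
    then have "(-1) ^ (k + 1) * u (k + 1) $ 0 + (-1) ^ (k + 1) * u (k + 1) $ 1 = (-1) ^ (k + 1)"
      by (metis distrib_left mult.right_neutral)
    ultimately show ?thesis
      using that by (simp add: barycenter_rhs_def Let_def)
  qed
  from this[of k] this[of "k + 1"]
  have "barycenter_rhs m 2 u $ (2 * k) + barycenter_rhs m 2 u $ (2 * k + 1) = (-1) ^ (k + 1)"
    "barycenter_rhs m 2 u $ (2 * k + 2) + barycenter_rhs m 2 u $ (2 * k + 3) = - ((-1) ^ (k + 1))"
    using assms(2) by (simp_all add: numeral_3_eq_3)
  moreover have "barycenter_rhs m 2 u $ (2 * m + 2 * k) = 0" "barycenter_rhs m 2 u $ (2 * m + 2 * k + 1) = 0"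
    using assms(2) by (simp_all add: barycenter_rhs_def Let_def)
  ultimately show ?thesis by linarith
qed

lemma solutions_barycenter_mat_2:
  assumes "\<forall>k\<in>{1..m}. u k \<in> prob_simplex 2"
  shows "solutions (remove_rows (barycenter_mat m 2) (barycenter_redundant m))
      (remove_entries (barycenter_rhs m 2 u) (barycenter_redundant m)) =
    solutions (barycenter_mat m 2) (barycenter_rhs m 2 u)"
proof -
  let ?A = "barycenter_mat m 2" and ?R = "barycenter_redundant m" and ?b = "barycenter_rhs m 2 u"
  have dim: "dim_vec ?b = dim_row ?A" by (simp add: barycenter_rhs_def)
  have sol: "solutions ?A ?b = {x \<in> carrier_vec (dim_col ?A). \<forall>i<dim_row ?A. row ?A i \<bullet> x = ?b $ i}"
    using dim by (auto simp: solutions_def vec_eq_iff)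
  \<comment> \<open>Only the removed equations are in question. Pairing the row dependency with
    \<open>x\<close> turns each into a combination of kept equations.\<close>
  have "row ?A i \<bullet> x = ?b $ i"
    if x: "x \<in> carrier_vec (dim_col ?A)" and eq: "\<forall>i<dim_row ?A. i \<notin> ?R \<longrightarrow> row ?A i \<bullet> x = ?b $ i"
      and i: "i \<in> ?R" for x i
  proof -
    obtain k where k: "k < m - 1" "i = 2 * m + 2 * k + 1" using i by (auto simp: barycenter_redundant_def)
    have eq': "row ?A r \<bullet> x = ?b $ r" if "r < 2 * m \<or> r = 2 * m + 2 * k" for r
    proof -
      have "r \<notin> ?R" using that unfolding barycenter_redundant_def by auto presburger
      moreover have "r < dim_row ?A" using that k by auto
      ultimately show ?thesis using eq by blast
    qed
    have row: "row ?A r \<in> carrier_vec (4 * m)" for r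
      using row_carrier[of ?A r] unfolding dim_barycenter_mat_2 .
    have x': "x \<in> carrier_vec (4 * m)" using x unfolding dim_barycenter_mat_2 .
    have "2 * k < 2 * m" "2 * k + 1 < 2 * m" "2 * k + 2 < 2 * m" "2 * k + 3 < 2 * m"
      using k(1) by linarith+
    then show ?thesis
      unfolding k(2) row_barycenter_mat_2_redundant[OF k(1)] barycenter_rhs_2_redundant[OF assms k(1)]
      by (simp add: smult_scalar_prod_distrib[of _ "4 * m"] add_scalar_prod_distrib[of _ "4 * m"] row x' eq'
          del: row_carrier_vec)
  qed
  then show ?thesis unfolding sol solutions_remove_rows[OF dim] by blast
qed

section \<open>Total unimodularity of the kept rows\<close>

lemma totally_unimodular_barycenter_mat_2:
  "totally_unimodular (remove_rows (barycenter_mat m 2) (barycenter_redundant m))"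
proof (rule totally_unimodular_remove_rows_peeling)
  let ?A = "barycenter_mat m 2" and ?R = "barycenter_redundant m"
  \<comment> \<open>A kept row outside the upper part has even offset, since the odd offsets are the
    removed ones; it is some g_k.\<close>
  have lower: "\<exists>k<m - 1. r = 2 * m + 2 * k" if r: "r \<in> {..<dim_row ?A} - ?R" "\<not> r < 2 * m" for r
  proof -
    obtain q where q: "r = 2 * m + q" using r(2) by (auto simp: not_less le_iff_add)
    then have "q = 2 * (q div 2) \<or> q = 2 * (q div 2) + 1" by presburger
    moreover have "q div 2 < m - 1" using r(1) q by auto
    ultimately show ?thesis using r(1) q by (auto simp: barycenter_redundant_def)
  qed
  have pm: "(-1) ^ k = (1::real) \<or> (-1) ^ k = (-1::real)" for k by (cases "even k") auto
  show "?A $$ (r, c) \<in> {-1, 0, 1}" if r: "r \<in> {..<dim_row ?A} - ?R" and c: "c < dim_col ?A" for r c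
  proof (cases "r < 2 * m")
    case True
    then show ?thesis using c pm[of "r div 2 + 1"] by (auto simp: barycenter_mat_2_upper)
  next
    case False
    then obtain k where "k < m - 1" "r = 2 * m + 2 * k" using lower[OF r] by blast
    then show ?thesis
      using c pm[of k] barycenter_mat_2_lower[of k m 0 c] by auto
  qed
  fix I J :: "nat set"
  assume fin: "finite I" "finite J" and ne: "I \<noteq> {}" "J \<noteq> {}"
    and I: "I \<subseteq> {..<dim_row ?A} - ?R" and J: "J \<subseteq> {..<dim_col ?A}"
  let ?row = "\<exists>r\<in>I. \<exists>c0. \<forall>c\<in>J. c \<noteq> c0 \<longrightarrow> ?A $$ (r, c) = 0"
  let ?col = "\<exists>c\<in>J. \<exists>r0. \<forall>r\<in>I. r \<noteq> r0 \<longrightarrow> ?A $$ (r, c) = 0"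
  let ?weights = "\<exists>w. (\<exists>r\<in>I. w r \<noteq> 0) \<and> (\<forall>c\<in>J. (\<Sum>r\<in>I. w r * ?A $$ (r, c)) = 0)"
  show "?row \<or> ?col \<or> ?weights"
  proof (cases "\<exists>i\<in>I. i < 2 * m")
    case True
    then obtain i where i: "i \<in> I" "i < 2 * m" by blast
    show ?thesis
    \<comment> \<open>Row \<open>i\<close> is supported on columns \<open>2 * i\<close> and
      \<open>2 * i + 1\<close>. Kept lower rows vanish on odd columns, so column
      \<open>2 * i + 1\<close> meets row \<open>i\<close> only: if it is in \<open>J\<close>, peel
      this column; if not, row \<open>i\<close> has at most the entry in column \<open>2 * i\<close>
      left and is peeled instead.\<close>
    proof (cases "2 * i + 1 \<in> J")
      case True
      have "?A $$ (r, 2 * i + 1) = 0" if r: "r \<in> I" "r \<noteq> i" for r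
      proof (cases "r < 2 * m")
        case True
        then show ?thesis using r i by (simp add: barycenter_mat_2_upper)
      next
        case False
        then obtain k where "k < m - 1" "r = 2 * m + 2 * k" using lower r I by blast
        then show ?thesis using i barycenter_mat_2_lower[of k m 0 "2 * i + 1"] by simp
      qed
      with True show ?thesis by blast
    next
      case False
      have "?A $$ (i, c) = 0" if "c \<in> J" "c \<noteq> 2 * i" for c
      proof -
        have "c \<noteq> 2 * i + 1" using False that by blast
        then have "c div 2 \<noteq> i" using that by presburger
        then show ?thesis using that i J by (auto simp: barycenter_mat_2_upper)
      qed
      with i show ?thesis by blast
    qed
  next
    case False
    then have I_lower: "\<exists>k<m - 1. r = 2 * m + 2 * k" if "r \<in> I" for r
      using that lower I by blast
    \<comment> \<open>The exponent recovers \<open>k\<close> from the row number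
      \<open>2 * m + 2 * k\<close> of g_k.\<close>
    define w :: "nat \<Rightarrow> real" where "w r = (-1) ^ ((r - 2 * m) div 2)" for r
    have "(\<Sum>r\<in>I. w r * ?A $$ (r, c)) = 0" if c: "c \<in> J" and "\<not> ?col" for c
    proof -
      define k where "k = c div 4"
      have c4: "c < 4 * m" using c J by auto
      \<comment> \<open>The guard \<open>k \<ge> 1\<close> is needed because \<open>k - 1\<close>
        would truncate to \<open>k\<close> at 0 and name the same row twice.\<close>
      have support: "r = 2 * m + 2 * k \<or> k \<ge> 1 \<and> r = 2 * m + 2 * (k - 1)"
        if "r \<in> I" "?A $$ (r, c) \<noteq> 0" for r
      proof -
        obtain l where "l < m - 1" "r = 2 * m + 2 * l" using I_lower \<open>r \<in> I\<close> by blast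
        then show ?thesis
          using that(2) barycenter_mat_2_lower[of l m 0 c] c4 by (auto simp: k_def split: if_splits)
      qed
      have two: "\<exists>r\<in>I. r \<noteq> r0 \<and> ?A $$ (r, c) \<noteq> 0" for r0 using that by blast
      \<comment> \<open>As no column can be peeled, excluding either candidate row forces the other
        into \<open>I\<close>. The nonzero entry recorded in \<open>nz\<close> also shows that
        \<open>c\<close> is even.\<close>
      from two[of "2 * m + 2 * k"] support have k: "k \<ge> 1" and in1: "2 * m + 2 * (k - 1) \<in> I"
        and nz: "?A $$ (2 * m + 2 * (k - 1), c) \<noteq> 0" by blast+
      from two[of "2 * m + 2 * (k - 1)"] support have in2: "2 * m + 2 * k \<in> I" by blast
      have lt: "k < m - 1" "k - 1 < m - 1" using I_lower[OF in2] by auto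
      have "(\<Sum>r\<in>I. w r * ?A $$ (r, c)) =
          (\<Sum>r\<in>{2 * m + 2 * k, 2 * m + 2 * (k - 1)}. w r * ?A $$ (r, c))"
        using fin in1 in2 support by (intro sum.mono_neutral_right) auto
      also have "\<dots> = w (2 * m + 2 * k) * ?A $$ (2 * m + 2 * k, c) +
          w (2 * m + 2 * (k - 1)) * ?A $$ (2 * m + 2 * (k - 1), c)"
        using k by (subst sum.insert) auto
      \<comment> \<open>Both entries are \<open>(-1) ^ k\<close>: column block \<open>k\<close> is
        the first block of row g_k and the second block of row g_(k-1). Only the weights differ in
        sign.\<close>
      also have "\<dots> = (-1) ^ k * (-1) ^ k + (-1) ^ (k - 1) * (-1) ^ k"
        using nz k barycenter_mat_2_lower[of k m 0 c] barycenter_mat_2_lower[of "k - 1" m 0 c] lt c4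
        by (auto simp: w_def k_def[symmetric] split: if_splits)
      also have "\<dots> = 0" using k by (cases k) auto
      finally show ?thesis .
    qed
    moreover have "\<exists>r\<in>I. w r \<noteq> 0" using ne by (auto simp: w_def)
    ultimately show ?thesis by blast
  qed
qed

theorem theorem3p6:
  fixes m n :: nat
  assumes "m \<ge> 3" and "n = 2"
  shows "\<exists>R. redundant_rows (barycenter_mat m n) R \<and>
           (\<forall>u. (\<forall>k\<in>{1..m}. u k \<in> prob_simplex n) \<longrightarrow>
              solutions (remove_rows (barycenter_mat m n) R) (remove_entries (barycenter_rhs m n u) R)
              = solutions (barycenter_mat m n) (barycenter_rhs m n u)) \<and>
           totally_unimodular (remove_rows (barycenter_mat m n) R)"
  unfolding \<open>n = 2\<close>
  using redundant_rows_barycenter_mat_2 solutions_barycenter_mat_2 totally_unimodular_barycenter_mat_2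
  by blast

end
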